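(* Let $(\mathbf{X}, d)$ be a proper geodesic space and let $\Omega$ be an open subset of $\mathbf{X}$. Assume that $u:\Omega\to\mathbb{R}$ satisfies the comparison with cones from below in $\Omega$. Assume that $u\ge0$ in $B_R(x_0)$ with $B_R(x_0)\subset\Omega$. Then $$u(y)\le3u(x)$$ for any $x,y\in B_r(x_0)$ and any $r>0$ with $4r<R$. In addition, if $\Omega$ is connected, $u$ is lower semicontinuous and nonnegative on $\Omega$, and $\sup_\Omega u>0$, then $u>0$ in $\Omega$.
   Context: A metric space $(\mathbf{X},d)$ is a geodesic space if any $x,y\in\mathbf{X}$ are joined by a Lipschitz curve of length $d(x,y)$; it is proper if all closed balls $\overline{B_r(x)}$ are compact. $B_r(x)$ is the open metric ball. $\mathcal{O}\subset\subset\Omega$ means $\overline{\mathcal{O}}\subset\Omega$. Comparison with cones from below in $\Omega$: for any $\hat{x}\in\Omega$, $a\in\mathbb{R}$, $\kappa\le 0$ and any bounded open set $\mathcal{O}\subset\subset\Omega$ with $\hat{x}\in\Omega\setminus\mathcal{O}$, if $u\ge\phi$ on $\partial\mathcal{O}$, where $\phi=a+\kappa d(\hat{x},\cdot)$, then $u\ge\phi$ in $\overline{\mathcal{O}}$. *)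

theory Defs
  imports "HOL-Analysis.Analysis"
begin

text \<open>The ambient metric space is the whole type \<^typ>\<open>'a::metric_space\<close>, with distance \<^const>\<open>dist\<close>.\<close>

text \<open>Length of a curve on \<open>[a, b]\<close>: supremum of the lengths of its inscribed polygons, where an
  increasing list of parameters plays the role of a partition.\<close>

definition curve_length :: "real \<Rightarrow> real \<Rightarrow> (real \<Rightarrow> 'a::metric_space) \<Rightarrow> ennreal" where
  "curve_length a b \<gamma> =
     (SUP ts \<in> {ts. sorted ts \<and> set ts \<subseteq> {a..b}}.
        ennreal (\<Sum>i<length ts - 1. dist (\<gamma> (ts ! i)) (\<gamma> (ts ! Suc i))))"

definition geodesic_space :: "'a::metric_space itself \<Rightarrow> bool" where
  "geodesic_space _ \<longleftrightarrow>
     (\<forall>x y :: 'a. \<exists>a b \<gamma> L. a \<le> b \<and> L-lipschitz_on {a..b} \<gamma> \<and> \<gamma> a = x \<and> \<gamma> b = y \<and>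
        curve_length a b \<gamma> = ennreal (dist x y))"

definition proper_space :: "'a::metric_space itself \<Rightarrow> bool" where
  "proper_space _ \<longleftrightarrow> (\<forall>(x :: 'a) r. compact (cball x r))"

text \<open>A function on \<open>\<Omega>\<close> is represented by a total function of which only the values on \<open>\<Omega>\<close>
  are used: below, \<open>frontier V\<close> and \<open>closure V\<close> both lie in \<open>\<Omega>\<close>.\<close>

definition comparison_with_cones_below :: "'a::metric_space set \<Rightarrow> ('a \<Rightarrow> real) \<Rightarrow> bool" where
  "comparison_with_cones_below \<Omega> u \<longleftrightarrow>
     (\<forall>z \<in> \<Omega>. \<forall>a \<kappa> :: real. \<forall>V.
        \<kappa> \<le> 0 \<and> bounded V \<and> open V \<and> closure V \<subseteq> \<Omega> \<and> z \<in> \<Omega> - V \<and>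
        (\<forall>x \<in> frontier V. u x \<ge> a + \<kappa> * dist z x) \<longrightarrow>
        (\<forall>x \<in> closure V. u x \<ge> a + \<kappa> * dist z x))"

definition lsc_on :: "'a::topological_space set \<Rightarrow> ('a \<Rightarrow> real) \<Rightarrow> bool" where
  "lsc_on S f \<longleftrightarrow> (\<forall>x \<in> S. \<forall>c < f x. eventually (\<lambda>y. c < f y) (at x within S))"

end

theory Submission
  imports Defs
begin

text \<open>
  Everything rests on one choice of cone. Let \<open>u\<close> be nonnegative on a closed ball of radius
  \<open>\<rho>\<close> about \<open>y\<close>, and compare \<open>u\<close>, on the punctured open ball, with the cone whose vertex is
  \<open>y\<close>, whose height is \<open>u y\<close> and which reaches \<open>0\<close> at distance \<open>\<rho>\<close>. A boundary point
  of the punctured ball is either \<open>y\<close>, where the cone equals \<open>u\<close>, or a point at distance \<open>\<rho>\<close>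
  from \<open>y\<close>, where the cone vanishes; so \<open>u\<close> lies above the cone inside
  (\<open>comparison_with_cones_below_cone_bound\<close>). Two points of a ball of radius \<open>r\<close> are less than
  \<open>2 * r\<close> apart, while each is the centre of a closed ball of radius \<open>3 * r\<close> inside the ball of
  radius \<open>4 * r\<close>. Hence the cone from one point has kept at least \<open>1 - 2/3\<close> of its height at
  the other, which is the Harnack inequality with constant 3.

  The Harnack inequality is symmetric in the two points, so for a nonnegative \<open>u\<close> positivity at
  one point and positivity at a nearby point are equivalent. Positivity is then locally constant,
  and on a connected set it propagates from one point to all of them.
\<close>

text \<open>
  Comparison is made on the ball with its centre removed: the centre serves as the vertex of the
  cone, so it has to lie outside the open set of comparison. If it is a boundary point of that
  set, the boundary inequality there is an equality, because the cone has height \<open>u y\<close>.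
\<close>

lemma comparison_with_cones_below_cone_bound:
  fixes u :: "'a::metric_space \<Rightarrow> real"
  assumes cwc: "comparison_with_cones_below \<Omega> u"
    and "0 < \<rho>" and sub: "cball y \<rho> \<subseteq> \<Omega>"
    and nonneg: "\<And>w. w \<in> cball y \<rho> \<Longrightarrow> 0 \<le> u w"
    and x: "x \<in> cball y \<rho>"
  shows "u y * (1 - dist y x / \<rho>) \<le> u x"
proof -
  define V where "V = ball y \<rho> - {y}"
  have "open V"
    unfolding V_def by (intro open_Diff) auto
  have closure_V: "closure V \<subseteq> cball y \<rho>"
    unfolding V_def by (rule closure_minimal) auto
  have frontier_V: "w = y \<or> dist y w = \<rho>" if "w \<in> frontier V" for w
  proof -
    have "w \<in> cball y \<rho>" "w \<notin> V"
      using that closure_V \<open>open V\<close> by (auto simp: frontier_def interior_open)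
    then show ?thesis
      by (auto simp: V_def)
  qed
  have y: "y \<in> cball y \<rho>"
    using \<open>0 < \<rho>\<close> by simp
  have "\<forall>w \<in> frontier V. u y + (- u y / \<rho>) * dist y w \<le> u w"
  proof
    fix w assume "w \<in> frontier V"
    then consider "w = y" | "dist y w = \<rho>"
      using frontier_V by blast
    then show "u y + (- u y / \<rho>) * dist y w \<le> u w"
      using nonneg[of w] \<open>0 < \<rho>\<close> by cases auto
  qed
  moreover have "- u y / \<rho> \<le> 0"
    using nonneg[OF y] \<open>0 < \<rho>\<close> by simp
  moreover have "bounded V"
    unfolding V_def by (rule bounded_subset[OF bounded_ball]) auto
  moreover have "y \<in> \<Omega> - V"
    using sub y by (auto simp: V_def)
  ultimately have cone: "\<forall>w \<in> closure V. u y + (- u y / \<rho>) * dist y w \<le> u w"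
    using cwc \<open>open V\<close> closure_V sub y
    unfolding comparison_with_cones_below_def by blast
  \<comment> \<open>Points at distance exactly \<open>\<rho>\<close> need not lie in the closure of the open ball, but there
    the cone vanishes.\<close>
  consider "x = y" | "dist y x = \<rho>" | "x \<in> V"
    using x by (cases "x = y"; cases "dist y x = \<rho>") (auto simp: V_def)
  then show ?thesis
  proof cases
    case 3
    then have "x \<in> closure V"
      using closure_subset by blast
    then show ?thesis
      using cone by (auto simp: algebra_simps)
  qed (use nonneg[OF x] \<open>0 < \<rho>\<close> in auto)
qed

lemma harnack_inequality_cones_below:
  fixes u :: "'a::metric_space \<Rightarrow> real"
  assumes cwc: "comparison_with_cones_below \<Omega> u"
    and sub: "ball x0 R \<subseteq> \<Omega>"
    and nonneg: "\<And>w. w \<in> ball x0 R \<Longrightarrow> 0 \<le> u w"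
    and r: "0 < r" "4 * r < R"
    and x: "x \<in> ball x0 r" and y: "y \<in> ball x0 r"
  shows "u y \<le> 3 * u x"
proof -
  have dist_xy: "dist y x < 2 * r"
    using x y dist_triangle2[of y x x0] by (simp add: dist_commute)
  have ball: "cball y (3 * r) \<subseteq> ball x0 R"
  proof
    fix w assume "w \<in> cball y (3 * r)"
    then show "w \<in> ball x0 R"
      using y r dist_triangle[of x0 w y] by simp
  qed
  have "u y * (1 / 3) \<le> u y * (1 - dist y x / (3 * r))"
  proof (rule mult_left_mono)
    show "1 / 3 \<le> 1 - dist y x / (3 * r)"
      using dist_xy r by (simp add: field_simps)
    show "0 \<le> u y"
      using y r by (intro nonneg) simp
  qed
  also have "\<dots> \<le> u x"
  proof (rule comparison_with_cones_below_cone_bound[OF cwc])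
    show "0 < 3 * r" "x \<in> cball y (3 * r)"
      using r dist_xy by simp_all
    show "cball y (3 * r) \<subseteq> \<Omega>"
      using ball sub by (rule subset_trans)
    show "0 \<le> u w" if "w \<in> cball y (3 * r)" for w
      using ball that by (intro nonneg) (rule subsetD)
  qed
  finally show ?thesis
    by simp
qed

text \<open>
  Around any point of \<open>\<Omega>\<close>, the Harnack inequality applied in both directions shows that \<open>u\<close> is
  either positive throughout a small ball or nowhere positive in it, so the points where \<open>u\<close>
  is positive and the points where it is zero form two open sets covering \<open>\<Omega>\<close>.
\<close>

lemma strong_minimum_principle_cones_below:
  fixes u :: "'a::metric_space \<Rightarrow> real"
  assumes cwc: "comparison_with_cones_below \<Omega> u"
    and "open \<Omega>" "connected \<Omega>"
    and nonneg: "\<And>w. w \<in> \<Omega> \<Longrightarrow> 0 \<le> u w"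
    and z: "z \<in> \<Omega>" "0 < u z" and x: "x \<in> \<Omega>"
  shows "0 < u x"
proof -
  have near: "\<exists>r > 0. ball w r \<subseteq> \<Omega> \<and> (\<forall>v \<in> ball w r. 0 < u v \<longleftrightarrow> 0 < u w)" if w: "w \<in> \<Omega>" for w
  proof -
    obtain R where R: "0 < R" "ball w R \<subseteq> \<Omega>"
      using openE[OF \<open>open \<Omega>\<close> w] by metis
    \<comment> \<open>Any radius below \<open>R / 4\<close> satisfies the hypothesis of the Harnack inequality.\<close>
    define r where "r = R / 5"
    have r: "0 < r" "4 * r < R"
      using R by (auto simp: r_def)
    have "0 < u v \<longleftrightarrow> 0 < u w" if v: "v \<in> ball w r" for v
    proof -
      have "w \<in> ball w r"
        using r by simp
      then have "u v \<le> 3 * u w" "u w \<le> 3 * u v"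
        using v
        by (auto intro: harnack_inequality_cones_below[OF cwc R(2) nonneg[OF subsetD[OF R(2)]] r])
      then show ?thesis
        by linarith
    qed
    moreover have "ball w r \<subseteq> \<Omega>"
      using R r by (auto simp: subset_iff)
    ultimately show ?thesis
      using r by blast
  qed
  define P where "P = {w \<in> \<Omega>. 0 < u w}"
  define Z where "Z = {w \<in> \<Omega>. \<not> 0 < u w}"
  have "open P"
    unfolding open_contains_ball
  proof
    fix w assume "w \<in> P"
    with near[of w] show "\<exists>r > 0. ball w r \<subseteq> P"
      unfolding P_def by blast
  qed
  moreover have "open Z"
    unfolding open_contains_ball
  proof
    fix w assume "w \<in> Z"
    with near[of w] show "\<exists>r > 0. ball w r \<subseteq> Z"
      unfolding Z_def by blast
  qed
  moreover have "P \<inter> Z \<inter> \<Omega> = {}" "\<Omega> \<subseteq> P \<union> Z" "P \<inter> \<Omega> \<noteq> {}"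
    using z by (auto simp: P_def Z_def)
  ultimately have "Z \<inter> \<Omega> = {}"
    using connectedD[OF \<open>connected \<Omega>\<close>] by blast
  then show ?thesis
    using x by (auto simp: Z_def)
qed

theorem proposition2p6:
  fixes \<Omega> :: "'a::metric_space set" and u :: "'a \<Rightarrow> real"
  assumes "proper_space TYPE('a)" and "geodesic_space TYPE('a)"
    and "open \<Omega>"
    and "comparison_with_cones_below \<Omega> u"
  shows "(\<forall>x0 R. ball x0 R \<subseteq> \<Omega> \<and> (\<forall>x \<in> ball x0 R. u x \<ge> 0) \<longrightarrow>
            (\<forall>r > 0. 4 * r < R \<longrightarrow> (\<forall>x \<in> ball x0 r. \<forall>y \<in> ball x0 r. u y \<le> 3 * u x)))
       \<and> (connected \<Omega> \<and> lsc_on \<Omega> u \<and> (\<forall>x \<in> \<Omega>. u x \<ge> 0) \<and> (SUP x \<in> \<Omega>. ereal (u x)) > 0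
            \<longrightarrow> (\<forall>x \<in> \<Omega>. u x > 0))"
proof (intro conjI impI allI ballI; (elim conjE)?)
  fix x0 R r x y
  assume "ball x0 R \<subseteq> \<Omega>" "\<forall>x \<in> ball x0 R. u x \<ge> 0"
    "0 < r" "4 * r < R" "x \<in> ball x0 r" "y \<in> ball x0 r"
  then show "u y \<le> 3 * u x"
    using harnack_inequality_cones_below[OF assms(4)] by blast
next
  fix x
  assume "x \<in> \<Omega>" "connected \<Omega>" "\<forall>x \<in> \<Omega>. u x \<ge> 0" and sup: "(SUP x \<in> \<Omega>. ereal (u x)) > 0"
  moreover obtain z where "z \<in> \<Omega>" "0 < u z"
    using sup by (auto simp: less_SUP_iff)
  ultimately show "0 < u x"
    using strong_minimum_principle_cones_below[OF assms(4,3)] by blast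
qed

end
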